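(* Let $X_1,\dots,X_n,Z$ be absolutely continuous random variables, let $f_Z$ be the probability density function of $Z$, let $H(x_1,\dots,x_n,z)=P\{X_1\le x_1,\dots,X_n\le x_n,Z\le z\}$ be the joint distribution function of $(X_1,\dots,X_n,Z)$, and let $F_{X_i,Z}(x_i,z)=P\{X_i\le x_i,Z\le z\}$, $i=1,\dots,n$. Write $\dot H(x_1,\dots,x_n,z)=\frac{\partial}{\partial z}H(x_1,\dots,x_n,z)$ and $\dot F_{X_i,Z}(x_i,z)=\frac{\partial}{\partial z}F_{X_i,Z}(x_i,z)$. If $f_Z(z)>0$, then $X_1,\dots,X_n$ are conditionally independent given $Z=z$ if and only if $$\dot H(x_1,\dots,x_n,z)=\left(\frac{1}{f_Z(z)}\right)^{n-1}\prod_{i=1}^n\dot F_{X_i,Z}(x_i,z)\qquad\text{for all }(x_1,\dots,x_n)\in\mathbb{R}^n.$$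
   Context: The random variables $X_1,\dots,X_n$ are said to be conditionally independent given $Z$ if $$P\{X_1\le x_1,\dots,X_n\le x_n\mid Z=z\}=\prod_{i=1}^nP\{X_i\le x_i\mid Z=z\}$$ for all $(x_1,\dots,x_n,z)\in\mathbb{R}^{n+1}$; conditional independence given $Z=z$, for a particular value $z$, means that this equality holds at that $z$ for all $(x_1,\dots,x_n)\in\mathbb{R}^n$.
   Formalization: The density is assumed to satisfy f_Z(z) = F_Z'(z) at the given z, the z-partial derivatives of H and F_{X_i,Z} are assumed to exist at z, and P{·|Z=z} is read as the limit of P{·|z-e≤Z≤z+e} as e→0+. *)

theory Defs
  imports "HOL-Probability.Probability"
begin

text \<open>
  Since P(Z = z) = 0, the conditional probability given Z = z is the limit of the elementary
  conditional probabilities given that Z lies in an interval shrinking to z.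
\<close>

definition has_cond_prob ::
  "'a measure \<Rightarrow> ('a \<Rightarrow> bool) \<Rightarrow> ('a \<Rightarrow> real) \<Rightarrow> real \<Rightarrow> real \<Rightarrow> bool" where
  "has_cond_prob M P Z z p \<longleftrightarrow>
     ((\<lambda>e. \<P>(\<omega> in M. P \<omega> \<bar> Z \<omega> \<in> {z - e..z + e})) \<longlongrightarrow> p) (at_right 0)"

lemma right_average_tendsto:
  fixes f :: "real \<Rightarrow> real"
  assumes "integrable lborel f"
  shows "AE z in lborel. ((\<lambda>e. (LINT t:{z..z + e}|lborel. f t) / e) \<longlongrightarrow> f z) (at_right 0)"
proof -
  have si: "set_integrable lborel {a..b} f" for a b
    using assms unfolding set_integrable_def
    by (intro integrable_mult_indicator) auto
  have int: "f integrable_on cbox a b" for a b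
    using set_borel_integral_eq_integral(1)[OF si] by simp
  obtain N where N: "negligible N"
    "\<And>x e. \<lbrakk>x \<notin> N; 0 < e\<rbrakk> \<Longrightarrow> \<exists>d>0. \<forall>h. 0 < h \<and> h < d \<longrightarrow>
        norm (integral (cbox x (x + h *\<^sub>R One)) f /\<^sub>R h ^ DIM(real) - f x) < e"
    using integrable_ccontinuous_explicit[of f, OF int] by metis
  have "AE z in lebesgue. z \<notin> N"
    using N(1) by (auto simp: negligible_iff_null_sets intro: AE_not_in)
  then have "AE z in lborel. z \<notin> N"
    by (simp add: AE_completion_iff)
  then show ?thesis
  proof eventually_elim
    case (elim z)
    show ?case
      unfolding tendsto_iff eventually_at_right_field
    proof (intro allI impI)
      fix r :: real assume "r > 0"
      from N(2)[OF elim this] obtain d where d: "d > 0"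
        "\<And>h. 0 < h \<Longrightarrow> h < d \<Longrightarrow> \<bar>integral {z..z + h} f / h - f z\<bar> < r"
        by (auto simp: field_simps)
      show "\<exists>b>0. \<forall>y>0. y < b \<longrightarrow> dist ((LINT t:{z..z + y}|lborel. f t) / y) (f z) < r"
        using d by (intro exI[of _ d])
          (auto simp: dist_real_def set_borel_integral_eq_integral(2)[OF si])
    qed
  qed
qed

lemma average_tendsto:
  fixes f :: "real \<Rightarrow> real"
  assumes f: "integrable lborel f"
  shows "AE z in lborel. ((\<lambda>e. (LINT t:{z - e..z + e}|lborel. f t) / e) \<longlongrightarrow> 2 * f z) (at_right 0)"
proof -
  have f': "integrable lborel (\<lambda>t. f (- t))"
    using lborel_integrable_real_affine[OF f, of "-1" 0] by simp
  have neg: "distr lborel borel uminus = (lborel :: real measure)"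
    by (rule lborel_distr_uminus)
  have "AE z in distr lborel borel uminus.
      ((\<lambda>e. (LINT t:{z..z + e}|lborel. f (- t)) / e) \<longlongrightarrow> f (- z)) (at_right 0)"
    unfolding neg by (rule right_average_tendsto[OF f'])
  then have "AE z in lborel. 
      ((\<lambda>e. (LINT t:{- z..- z + e}|lborel. f (- t)) / e) \<longlongrightarrow> f (- (- z))) (at_right 0)"
    by (rule AE_distrD[rotated]) auto
  with right_average_tendsto[OF f] show ?thesis
  proof eventually_elim
    case (elim z)
    have si: "set_integrable lborel {a..b} f" for a b
      using f unfolding set_integrable_def by (intro integrable_mult_indicator) auto
    have "(LINT t:{- z..- z + e}|lborel. f (- t)) = (LINT t:{z - e..z}|lborel. f t)" for e
      unfolding set_lebesgue_integral_def
      by (subst (2) lborel_integral_real_affine[of "-1" _ 0])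
         (auto simp: indicator_def intro!: Bochner_Integration.integral_cong)
    moreover have "(LINT t:{z - e..z}|lborel. f t) + (LINT t:{z..z + e}|lborel. f t) 
        = (LINT t:{z - e..z + e}|lborel. f t)" if "e > 0" for e
    proof -
      have "integral {z - e..z} f + integral {z..z + e} f = integral {z - e..z + e} f"
        using that set_borel_integral_eq_integral(1)[OF si]
        by (intro Henstock_Kurzweil_Integration.integral_combine) auto
      then show ?thesis
        by (simp add: set_borel_integral_eq_integral(2)[OF si])
    qed
    ultimately have *: "(LINT t:{- z..- z + e}|lborel. f (- t)) / e + (LINT t:{z..z + e}|lborel. f t) / e
        = (LINT t:{z - e..z + e}|lborel. f t) / e" if "e > 0" for e
      using that by (simp add: add_divide_distrib[symmetric])
    have "((\<lambda>e. (LINT t:{- z..- z + e}|lborel. f (- t)) / e + (LINT t:{z..z + e}|lborel. f t) / e)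
        \<longlongrightarrow> f z + f z) (at_right 0)"
      using elim by (intro tendsto_add) auto
    moreover have "\<forall>\<^sub>F e in at_right 0. (LINT t:{- z..- z + e}|lborel. f (- t)) / e +
        (LINT t:{z..z + e}|lborel. f t) / e = (LINT t:{z - e..z + e}|lborel. f t) / e"
      using eventually_at_right_less[of 0] by eventually_elim (rule *)
    ultimately have "((\<lambda>e. (LINT t:{z - e..z + e}|lborel. f t) / e) \<longlongrightarrow> f z + f z) (at_right 0)"
      by (rule Lim_transform_eventually)
    then show ?case by (simp only: mult_2)
  qed
qed

lemma finite_measure_density_tendsto:
  fixes N :: "real measure"
  assumes fin: "finite_measure N" and [simp]: "sets N = sets borel" and ac: "absolutely_continuous lborel N"
  obtains f where "f \<in> borel_measurable borel" "\<And>t. 0 \<le> f t" "integrable lborel f"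
    "N = density lborel (\<lambda>t. ennreal (f t))"
    "AE z in lborel. ((\<lambda>e. measure N {z - e..z + e} / e) \<longlongrightarrow> 2 * f z) (at_right 0)"
proof -
  interpret finite_measure N by fact
  obtain f where f: "f \<in> borel_measurable lborel" "\<And>t. 0 \<le> f t"
    and RN: "AE t in lborel. RN_deriv lborel N t = ennreal (f t)"
    using sigma_finite_measure.real_RN_deriv[OF lborel.sigma_finite_measure_axioms fin ac]
    by (metis assms(2) sets_lborel)
  have N: "N = density lborel (\<lambda>t. ennreal (f t))"
    using sigma_finite_measure.density_RN_deriv[OF lborel.sigma_finite_measure_axioms ac] density_cong[OF _ _ RN] f(1) by simp
  have "(\<integral>\<^sup>+t. ennreal (f t) \<partial>lborel) = emeasure N UNIV"
    unfolding N using f(1) by (simp add: emeasure_density)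
  then have int: "integrable lborel f"
    using f emeasure_finite[of UNIV]
    by (intro integrableI_nonneg) (auto simp: less_top[symmetric])
  have "measure N {a..b} = (LINT t:{a..b}|lborel. f t)" for a b
  proof -
    have "measure N {a..b} = (\<integral>t. indicator {a..b} t \<partial>N)" by simp
    also have "\<dots> = (LINT t:{a..b}|lborel. f t)"
      unfolding set_lebesgue_integral_def using f
      by (subst N, subst integral_density) (auto simp: mult.commute)
    finally show ?thesis .
  qed
  with that[of f] f int N average_tendsto[OF int] show ?thesis by simp
qed

text \<open>
  The limit selects a version of the usual conditional probability: it exists for almost every
  value of Z and agrees with the conditional expectation of the indicator given Z.
\<close>

lemma (in prob_space) has_cond_prob_AE:
  assumes Z[measurable]: "Z \<in> borel_measurable M"
    and acZ: "absolutely_continuous lborel (distr M borel Z)"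
    and P[measurable]: "Measurable.pred M P"
  shows "AE \<omega> in M. has_cond_prob M P Z (Z \<omega>)
    (real_cond_exp M (vimage_algebra (space M) Z borel) (indicator {\<omega> \<in> space M. P \<omega>}) \<omega>)"
proof -
  define A where "A = {\<omega> \<in> space M. P \<omega>}"
  have A[measurable]: "A \<in> events" unfolding A_def by measurable
  define N1 where "N1 = distr M borel Z"
  define N2 where "N2 = distr (density M (indicator A)) borel Z"
  have Z'[measurable]: "Z \<in> borel_measurable (density M (indicator A))" by simp
  have em1: "emeasure N1 B = emeasure M (Z -` B \<inter> space M)" if "B \<in> sets borel" for B
    unfolding N1_def using that by (simp add: emeasure_distr)
  have em2: "emeasure N2 B = emeasure M (A \<inter> (Z -` B \<inter> space M))" if "B \<in> sets borel" for B
  proof -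
    have [measurable]: "Z -` B \<inter> space M \<in> events" using that by measurable
    show ?thesis
      unfolding N2_def using that
      by (simp add: emeasure_distr emeasure_density indicator_inter_arith[symmetric])
  qed
  have le: "emeasure N2 B \<le> emeasure N1 B" if "B \<in> sets borel" for B
    unfolding em1[OF that] em2[OF that]
    using that by (intro emeasure_mono) auto
  have fin1: "finite_measure N1"
    unfolding N1_def by (simp add: finite_measure_distr)
  have fin2: "finite_measure N2"
  proof (rule finite_measureI)
    have "space N2 = UNIV" by (simp add: N2_def)
    then show "emeasure N2 (space N2) \<noteq> \<infinity>" by (simp add: em2)
  qed
  have ac1: "absolutely_continuous lborel N1" using acZ by (simp add: N1_def)
  have ac2: "absolutely_continuous lborel N2"
    unfolding absolutely_continuous_def
  proof
    fix B :: "real set" assume "B \<in> null_sets lborel"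
    then have "B \<in> null_sets N1" using ac1 by (auto simp: absolutely_continuous_def)
    then show "B \<in> null_sets N2"
      using le[of B] by (auto simp: null_sets_def N1_def N2_def)
  qed
  obtain f1 where [measurable]: "f1 \<in> borel_measurable borel" and f1: "\<And>t. 0 \<le> f1 t" "integrable lborel f1"
    "N1 = density lborel (\<lambda>t. ennreal (f1 t))"
    "AE z in lborel. ((\<lambda>e. measure N1 {z - e..z + e} / e) \<longlongrightarrow> 2 * f1 z) (at_right 0)"
    using finite_measure_density_tendsto[OF fin1 _ ac1] by (auto simp: N1_def)
  obtain f2 where [measurable]: "f2 \<in> borel_measurable borel" and f2: "\<And>t. 0 \<le> f2 t" "integrable lborel f2"
    "N2 = density lborel (\<lambda>t. ennreal (f2 t))"
    "AE z in lborel. ((\<lambda>e. measure N2 {z - e..z + e} / e) \<longlongrightarrow> 2 * f2 z) (at_right 0)"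
    using finite_measure_density_tendsto[OF fin2 _ ac2] by (auto simp: N2_def)
  define g where "g t = f2 t / f1 t" for t
  have [measurable]: "g \<in> borel_measurable borel" unfolding g_def by measurable

  have z1: "AE t in N1. f1 t \<noteq> 0"
    unfolding f1(3) by (subst AE_density) auto
  then have "{t. f1 t = 0} \<in> null_sets N1"
    by (subst (asm) AE_iff_null) (auto simp: N1_def)
  then have "{t. f1 t = 0} \<in> null_sets N2"
    using le[of "{t. f1 t = 0}"] by (auto simp: null_sets_def N1_def N2_def)
  then have "AE t in N2. f1 t \<noteq> 0"
    by (subst AE_iff_null) (auto simp: N2_def)
  then have "AE t in lborel. f2 t \<noteq> 0 \<longrightarrow> f1 t \<noteq> 0"
    unfolding f2(3) using f2(1) by (subst (asm) AE_density) (auto simp: less_le)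
  then have gf: "AE t in lborel. f1 t * g t = f2 t"
    by eventually_elim (auto simp: g_def)

  have sub: "subalgebra M (vimage_algebra (space M) Z borel)"
    unfolding subalgebra_def using sets_image_in_sets[OF refl Z] by auto
  interpret F: finite_measure_subalgebra M "vimage_algebra (space M) Z borel"
    by unfold_locales (rule sub)
  have "integrable lborel (\<lambda>t. f1 t * g t)"
    by (rule integrable_cong_AE_imp[OF f2(2)]) (use gf in auto)
  then have gint: "integrable N1 g"
    unfolding f1(3) using f1(1) by (subst integrable_density) auto
  have ce: "AE \<omega> in M. real_cond_exp M (vimage_algebra (space M) Z borel) (indicator A) \<omega> = g (Z \<omega>)"
  proof (rule F.real_cond_exp_charact)
    show "integrable M (indicator A :: 'a \<Rightarrow> real)" by (simp add: integrable_indicator_iff less_top[symmetric])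
    show "integrable M (\<lambda>\<omega>. g (Z \<omega>))"
      using gint unfolding N1_def by (simp add: integrable_distr_eq)
    show "(\<lambda>\<omega>. g (Z \<omega>)) \<in> borel_measurable (vimage_algebra (space M) Z borel)"
      by (rule measurable_compose[OF measurable_vimage_algebra1]) auto
    fix B assume "B \<in> sets (vimage_algebra (space M) Z borel)"
    then obtain C where C[measurable]: "C \<in> sets borel" and B: "B = Z -` C \<inter> space M"
      by (auto simp: sets_vimage_algebra2)
    have [measurable]: "B \<in> events" unfolding B by measurable
    have "(\<integral>\<omega>\<in>B. indicator A \<omega> \<partial>M) = measure M (A \<inter> B)"
      unfolding set_lebesgue_integral_def by (simp add: indicator_inter_arith[symmetric] Int_commute)
    also have "\<dots> = measure N2 C"
      by (simp add: measure_def em2 B)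
    also have "\<dots> = (\<integral>t. indicator C t \<partial>N2)" by (simp add: N2_def)
    also have "\<dots> = (\<integral>t. f2 t * indicator C t \<partial>lborel)"
      unfolding f2(3) using f2(1) by (subst integral_density) auto
    also have "\<dots> = (\<integral>t. f1 t * (g t * indicator C t) \<partial>lborel)"
      using gf by (intro integral_cong_AE) auto
    also have "\<dots> = (\<integral>t. g t * indicator C t \<partial>N1)"
      unfolding f1(3) using f1(1) by (subst integral_density) auto
    also have "\<dots> = (\<integral>\<omega>. g (Z \<omega>) * indicator C (Z \<omega>) \<partial>M)"
      unfolding N1_def by (subst integral_distr) auto
    also have "\<dots> = (\<integral>\<omega>\<in>B. g (Z \<omega>) \<partial>M)"
      unfolding set_lebesgue_integral_def B
      by (intro Bochner_Integration.integral_cong) (auto simp: indicator_def)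
    finally show "(\<integral>\<omega>\<in>B. indicator A \<omega> \<partial>M) = (\<integral>\<omega>\<in>B. g (Z \<omega>) \<partial>M)" .
  qed

  have "AE z in N1. ((\<lambda>e. measure N1 {z - e..z + e} / e) \<longlongrightarrow> 2 * f1 z) (at_right 0)"
    by (rule absolutely_continuous_AE[OF _ ac1 f1(4)]) (simp add: N1_def)
  moreover have "AE z in N1. ((\<lambda>e. measure N2 {z - e..z + e} / e) \<longlongrightarrow> 2 * f2 z) (at_right 0)"
    by (rule absolutely_continuous_AE[OF _ ac1 f2(4)]) (simp add: N1_def)
  ultimately have "AE z in N1. has_cond_prob M P Z z (g z)"
    using z1
  proof eventually_elim
    case (elim z)
    have *: "\<P>(\<omega> in M. P \<omega> \<bar> Z \<omega> \<in> {z - e..z + e}) =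
        (measure N2 {z - e..z + e} / e) / (measure N1 {z - e..z + e} / e)" if "e > 0" for e
    proof -
      have "{\<omega> \<in> space M. P \<omega> \<and> Z \<omega> \<in> {z - e..z + e}} = A \<inter> (Z -` {z - e..z + e} \<inter> space M)"
        "{\<omega> \<in> space M. Z \<omega> \<in> {z - e..z + e}} = Z -` {z - e..z + e} \<inter> space M"
        by (auto simp: A_def)
      then show ?thesis
        using that by (simp only: cond_prob_def measure_def em1 em2 atLeastAtMost_borel) simp
    qed
    have ev: "\<forall>\<^sub>F e in at_right 0. (measure N2 {z - e..z + e} / e) / (measure N1 {z - e..z + e} / e) =
        \<P>(\<omega> in M. P \<omega> \<bar> Z \<omega> \<in> {z - e..z + e})"
      using eventually_at_right_less[of 0] by eventually_elim (rule *[symmetric])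
    have "((\<lambda>e. (measure N2 {z - e..z + e} / e) / (measure N1 {z - e..z + e} / e))
        \<longlongrightarrow> (2 * f2 z) / (2 * f1 z)) (at_right 0)"
      using elim by (intro tendsto_divide) auto
    then have "((\<lambda>e. (measure N2 {z - e..z + e} / e) / (measure N1 {z - e..z + e} / e))
        \<longlongrightarrow> g z) (at_right 0)"
      by (simp only: g_def mult_divide_mult_cancel_left_if) simp
    then show ?case
      unfolding has_cond_prob_def using ev by (rule Lim_transform_eventually)
  qed
  then have "AE \<omega> in M. has_cond_prob M P Z (Z \<omega>) (g (Z \<omega>))"
    unfolding N1_def by (rule AE_distrD[rotated]) auto
  with ce show ?thesis
    by eventually_elim (simp add: A_def)
qed

definition cond_indep_at ::
  "'a measure \<Rightarrow> nat \<Rightarrow> (nat \<Rightarrow> 'a \<Rightarrow> real) \<Rightarrow> ('a \<Rightarrow> real) \<Rightarrow> real \<Rightarrow> bool" where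
  "cond_indep_at M n X Z z \<longleftrightarrow>
     (\<forall>x :: nat \<Rightarrow> real. \<exists>p q.
        has_cond_prob M (\<lambda>\<omega>. \<forall>i\<in>{1..n}. X i \<omega> \<le> x i) Z z p \<and>
        (\<forall>i\<in>{1..n}. has_cond_prob M (\<lambda>\<omega>. X i \<omega> \<le> x i) Z z (q i)) \<and>
        p = (\<Prod>i=1..n. q i))"

definition joint_df ::
  "'a measure \<Rightarrow> nat \<Rightarrow> (nat \<Rightarrow> 'a \<Rightarrow> real) \<Rightarrow> ('a \<Rightarrow> real) \<Rightarrow> (nat \<Rightarrow> real) \<Rightarrow> real \<Rightarrow> real" where
  "joint_df M n X Z x z = \<P>(\<omega> in M. (\<forall>i\<in>{1..n}. X i \<omega> \<le> x i) \<and> Z \<omega> \<le> z)"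

definition pair_df ::
  "'a measure \<Rightarrow> ('a \<Rightarrow> real) \<Rightarrow> ('a \<Rightarrow> real) \<Rightarrow> real \<Rightarrow> real \<Rightarrow> real" where
  "pair_df M Y Z y z = \<P>(\<omega> in M. Y \<omega> \<le> y \<and> Z \<omega> \<le> z)"

end

theory Submission
  imports Defs
begin

text \<open>
  For a measurable event P put G(t) = P(P, Z \<le> t).  Since Z has a density f it has no atoms, so
  the probability of P together with z - e \<le> Z \<le> z + e is exactly G(z + e) - G(z - e).  The
  elementary conditional probability of P given that interval is therefore a quotient of two
  symmetric difference quotients, one of G and one of the distribution function of Z.  The first
  tends to G'(z) and the second to f(z) > 0, so the conditional probability of P given
  Z = z exists and equals G'(z) / f(z) (lemma \<open>has_cond_prob_derivative\<close>).

  Taking for P the joint event and each of the marginal events turns the factorisation of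
  conditional probabilities into an identity between derivatives, in which the left side is
  divided by f(z) once and the product on the right n times; clearing one factor leaves the
  power n - 1.
\<close>

text \<open>
  Inserting G z splits the quotient into the right and the left difference quotient of G at z.
\<close>

lemma symmetric_difference_quotient_tendsto:
  fixes G :: "real \<Rightarrow> real"
  assumes "(G has_real_derivative D) (at z)"
  shows "((\<lambda>e. (G (z + e) - G (z - e)) / e) \<longlongrightarrow> 2 * D) (at_right 0)"
proof -
  have lim: "((\<lambda>h. (G (z + h) - G z) / h) \<longlongrightarrow> D) (at 0)"
    using assms by (simp add: DERIV_def)
  have right: "((\<lambda>e. (G (z + e) - G z) / e) \<longlongrightarrow> D) (at_right 0)"
    by (rule tendsto_within_subset[OF lim]) auto
  have "filterlim (\<lambda>e::real. - e) (at 0) (at_right 0)"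
    by (auto simp: filterlim_at eventually_at_right_field intro!: tendsto_eq_intros exI[of _ 1])
  from filterlim_compose[OF lim this]
  have left: "((\<lambda>e. (G (z - e) - G z) / (- e)) \<longlongrightarrow> D) (at_right 0)"
    by simp
  have "(\<lambda>e. (G (z + e) - G (z - e)) / e)
      = (\<lambda>e. (G (z + e) - G z) / e + (G (z - e) - G z) / (- e))"
    by (rule ext) (simp add: diff_divide_distrib)
  then show ?thesis
    using tendsto_add[OF right left] by simp
qed

text \<open>
  The difference of the two distribution functions is the probability of the half-open interval
  {a<..b}; the absence of an atom at the left endpoint closes it.
\<close>

lemma (in prob_space) prob_interval_no_atom:
  fixes Z :: "'a \<Rightarrow> real"
  assumes Z[measurable]: "Z \<in> borel_measurable M" and P[measurable]: "Measurable.pred M P"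
    and atom: "\<P>(\<omega> in M. Z \<omega> = a) = 0" and "a \<le> b"
  shows "\<P>(\<omega> in M. P \<omega> \<and> Z \<omega> \<in> {a..b}) =
    \<P>(\<omega> in M. P \<omega> \<and> Z \<omega> \<le> b) - \<P>(\<omega> in M. P \<omega> \<and> Z \<omega> \<le> a)"
proof -
  have "AE \<omega> in M. Z \<omega> \<noteq> a"
    using atom by (subst (asm) prob_eq_0) auto
  then have "\<P>(\<omega> in M. P \<omega> \<and> Z \<omega> \<in> {a..b}) = \<P>(\<omega> in M. P \<omega> \<and> Z \<omega> \<in> {a<..b})"
    by (intro finite_measure_eq_AE) (auto elim!: eventually_mono)
  also have "\<dots> = measure M
      ({\<omega> \<in> space M. P \<omega> \<and> Z \<omega> \<le> b} - {\<omega> \<in> space M. P \<omega> \<and> Z \<omega> \<le> a})"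
    by (intro arg_cong[where f = "measure M"]) auto
  also have "\<dots> = \<P>(\<omega> in M. P \<omega> \<and> Z \<omega> \<le> b) - \<P>(\<omega> in M. P \<omega> \<and> Z \<omega> \<le> a)"
    using \<open>a \<le> b\<close> by (intro finite_measure_Diff) auto
  finally show ?thesis .
qed

text \<open>
  Numerator and denominator of the elementary conditional probability both vanish as the interval
  shrinks; after division by e they converge to 2 * D and 2 * f, and f being nonzero lets the
  limit pass through the quotient.
\<close>

lemma (in prob_space) has_cond_prob_derivative:
  assumes Z[measurable]: "Z \<in> borel_measurable M" and P[measurable]: "Measurable.pred M P"
    and atom: "\<And>a. \<P>(\<omega> in M. Z \<omega> = a) = 0"
    and G: "((\<lambda>t. \<P>(\<omega> in M. P \<omega> \<and> Z \<omega> \<le> t)) has_real_derivative D) (at z)"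
    and F: "(cdf (distr M borel Z) has_real_derivative f) (at z)" and "f \<noteq> 0"
  shows "has_cond_prob M P Z z (D / f)"
proof -
  let ?G = "\<lambda>t. \<P>(\<omega> in M. P \<omega> \<and> Z \<omega> \<le> t)"
  let ?F = "cdf (distr M borel Z)"
  \<comment> \<open>the trivial event makes the denominator an instance of the same interval formula\<close>
  have cdf: "?F t = \<P>(\<omega> in M. True \<and> Z \<omega> \<le> t)" for t
    unfolding cdf_def
    by (subst measure_distr) (auto intro!: arg_cong[where f = "measure M"])
  have quot: "\<forall>\<^sub>F e in at_right 0.
      ((?G (z + e) - ?G (z - e)) / e) / ((?F (z + e) - ?F (z - e)) / e) =
      \<P>(\<omega> in M. P \<omega> \<bar> Z \<omega> \<in> {z - e..z + e})"
    using eventually_at_right_less[of 0]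
  proof eventually_elim
    case (elim e)
    have "\<P>(\<omega> in M. P \<omega> \<and> Z \<omega> \<in> {z - e..z + e}) = ?G (z + e) - ?G (z - e)"
      using elim by (intro prob_interval_no_atom atom) auto
    moreover have "\<P>(\<omega> in M. True \<and> Z \<omega> \<in> {z - e..z + e}) = ?F (z + e) - ?F (z - e)"
      unfolding cdf using elim by (intro prob_interval_no_atom atom) auto
    ultimately show ?case
      using elim by (simp add: cond_prob_def)
  qed
  have "((\<lambda>e. ((?G (z + e) - ?G (z - e)) / e) / ((?F (z + e) - ?F (z - e)) / e))
      \<longlongrightarrow> (2 * D) / (2 * f)) (at_right 0)"
    using \<open>f \<noteq> 0\<close>
    by (intro tendsto_divide symmetric_difference_quotient_tendsto[OF G]
        symmetric_difference_quotient_tendsto[OF F]) simp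
  from Lim_transform_eventually[OF this quot] show ?thesis
    by (simp add: has_cond_prob_def)
qed

text \<open>
  Conditional independence only asserts that some conditional probabilities exist and factorise;
  uniqueness identifies them with the ratios of derivatives.
\<close>

lemma has_cond_prob_unique:
  assumes "has_cond_prob M P Z z p" "has_cond_prob M P Z z q"
  shows "p = q"
  using assms unfolding has_cond_prob_def
  by (rule tendsto_unique[OF trivial_limit_at_right_real])

lemma (in prob_space) distributed_lborel_no_atom:
  fixes Z :: "'a \<Rightarrow> real"
  assumes "distributed M lborel Z f"
  shows "\<P>(\<omega> in M. Z \<omega> = a) = 0"
proof -
  have [measurable]: "Z \<in> borel_measurable M"
    using distributed_measurable[OF assms] by simp
  have [measurable]: "f \<in> borel_measurable borel"
    using distributed_borel_measurable[OF assms] by simp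
  have "\<P>(\<omega> in M. Z \<omega> = a) = measure (distr M lborel Z) {a}"
    by (subst measure_distr) (auto intro!: arg_cong[where f = "measure M"])
  also have "\<dots> = 0"
    unfolding distributed_distr_eq_density[OF assms] measure_def
    by (subst emeasure_density)
       (auto intro!: nn_integral_null_set simp: emeasure_lborel_singleton null_sets_def)
  finally show ?thesis .
qed

theorem theorem1:
  fixes M :: "'a measure" and n :: nat and X :: "nat \<Rightarrow> 'a \<Rightarrow> real" and Z :: "'a \<Rightarrow> real"
    and f\<^sub>Z :: "real \<Rightarrow> real" and z :: real
  assumes "prob_space M"
    and "n \<ge> 1"
    and "\<And>i. i \<in> {1..n} \<Longrightarrow> X i \<in> borel_measurable M"
    and "\<And>i. i \<in> {1..n} \<Longrightarrow> absolutely_continuous lborel (distr M borel (X i))"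
    and "\<And>t. 0 \<le> f\<^sub>Z t"
    and "distributed M lborel Z (\<lambda>t. ennreal (f\<^sub>Z t))"
    and "(cdf (distr M borel Z) has_real_derivative f\<^sub>Z z) (at z)"
    and "\<And>x. joint_df M n X Z x differentiable (at z)"
    and "\<And>i y. i \<in> {1..n} \<Longrightarrow> pair_df M (X i) Z y differentiable (at z)"
    and "f\<^sub>Z z > 0"
  shows "cond_indep_at M n X Z z \<longleftrightarrow>
    (\<forall>x :: nat \<Rightarrow> real.
       deriv (joint_df M n X Z x) z =
         (1 / f\<^sub>Z z) ^ (n - 1) * (\<Prod>i=1..n. deriv (pair_df M (X i) Z (x i)) z))"
proof -
  interpret prob_space M by fact
  let ?f = "f\<^sub>Z z"
  let ?H = "\<lambda>x. deriv (joint_df M n X Z x) z"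
  let ?F = "\<lambda>i y. deriv (pair_df M (X i) Z y) z"
  have f: "?f \<noteq> 0" using assms(10) by simp
  have [measurable]: "Z \<in> borel_measurable M"
    using distributed_measurable[OF assms(6)] by simp
  have X[measurable]: "X i \<in> borel_measurable M" if "i \<in> {1..n}" for i
    using assms(3) that .
  note cond_prob = has_cond_prob_derivative[OF _ _ distributed_lborel_no_atom[OF assms(6)] _
      assms(7) f]
  have joint: "has_cond_prob M (\<lambda>\<omega>. \<forall>i\<in>{1..n}. X i \<omega> \<le> x i) Z z (?H x / ?f)" for x
  proof (rule cond_prob)
    show "((\<lambda>t. \<P>(\<omega> in M. (\<forall>i\<in>{1..n}. X i \<omega> \<le> x i) \<and> Z \<omega> \<le> t))
        has_real_derivative ?H x) (at z)"
      using assms(8)[of x] unfolding joint_df_def[abs_def]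
      by (simp add: DERIV_deriv_iff_real_differentiable)
  qed measurable
  have marginal: "has_cond_prob M (\<lambda>\<omega>. X i \<omega> \<le> y) Z z (?F i y / ?f)" if i: "i \<in> {1..n}" for i y
  proof (rule cond_prob)
    show "((\<lambda>t. \<P>(\<omega> in M. X i \<omega> \<le> y \<and> Z \<omega> \<le> t)) has_real_derivative ?F i y) (at z)"
      using assms(9)[OF i, of y] unfolding pair_df_def[abs_def]
      by (simp add: DERIV_deriv_iff_real_differentiable)
  qed (use X[OF i] in measurable)
  have "cond_indep_at M n X Z z \<longleftrightarrow> (\<forall>x. ?H x / ?f = (\<Prod>i=1..n. ?F i (x i) / ?f))"
    (is "_ \<longleftrightarrow> (\<forall>x. ?factor x)")
  proof
    assume indep: "cond_indep_at M n X Z z"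
    show "\<forall>x. ?factor x"
    proof
      fix x
      obtain p q where pq: "has_cond_prob M (\<lambda>\<omega>. \<forall>i\<in>{1..n}. X i \<omega> \<le> x i) Z z p"
        "\<And>i. i \<in> {1..n} \<Longrightarrow> has_cond_prob M (\<lambda>\<omega>. X i \<omega> \<le> x i) Z z (q i)"
        "p = (\<Prod>i=1..n. q i)"
        using indep unfolding cond_indep_at_def by blast
      have "?H x / ?f = (\<Prod>i=1..n. q i)"
        using has_cond_prob_unique[OF joint pq(1)] pq(3) by simp
      also have "\<dots> = (\<Prod>i=1..n. ?F i (x i) / ?f)"
        by (intro prod.cong refl has_cond_prob_unique[OF pq(2) marginal])
      finally show "?factor x" .
    qed
  next
    assume factor: "\<forall>x. ?factor x"
    show "cond_indep_at M n X Z z"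
      unfolding cond_indep_at_def
    proof
      fix x
      show "\<exists>p q. has_cond_prob M (\<lambda>\<omega>. \<forall>i\<in>{1..n}. X i \<omega> \<le> x i) Z z p \<and>
          (\<forall>i\<in>{1..n}. has_cond_prob M (\<lambda>\<omega>. X i \<omega> \<le> x i) Z z (q i)) \<and> p = (\<Prod>i=1..n. q i)"
        using joint[of x] marginal factor
        by (intro exI[of _ "?H x / ?f"] exI[of _ "\<lambda>i. ?F i (x i) / ?f"]) blast
    qed
  qed
  also have "\<dots> \<longleftrightarrow> (\<forall>x. ?H x = (1 / ?f) ^ (n - 1) * (\<Prod>i=1..n. ?F i (x i)))"
  proof (intro iff_allI)
    fix x
    have "?f ^ n = ?f ^ (n - 1) * ?f"
      using \<open>n \<ge> 1\<close> by (metis power_minus_mult less_le_trans zero_less_one)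
    then show "?factor x \<longleftrightarrow> ?H x = (1 / ?f) ^ (n - 1) * (\<Prod>i=1..n. ?F i (x i))"
      using f by (simp add: prod_dividef field_simps)
  qed
  finally show ?thesis .
qed

end
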